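(* Let $(X,d)$ and $(Y,d')$ be two complete metric invariant groups. Then a map $\Phi:(\mathcal{K}(X),\oplus,d_\infty)\to(\mathcal{K}(Y),\oplus,d_\infty)$ is a monoid isometric isomorphism if and only if there exists a group isometric isomorphism $T:(X,d)\to(Y,d')$ such that $\Phi(f)=f\circ T^{-1}$ for all $f\in\mathcal{K}(X)$. Consequently, $Aut_{Iso}(\mathcal{K}(X))$ is isomorphic, as a group, to $Aut_{Iso}(X)$.
   Context: A group $X$ with a metric $d$ is metric invariant if $d(xy,xz)=d(yx,zx)=d(y,z)$ for all $x,y,z\in X$; it is complete if $(X,d)$ is a complete metric space. A function $f:X\to\mathbb{R}$ is a Katetov map if $|f(x)-f(y)|\le d(x,y)\le f(x)+f(y)$ for all $x,y\in X$. $\mathcal{K}(X)$ is the set of all Katetov maps on $X$, with the metric $d_\infty(f,g)=\sup_{x\in X}|f(x)-g(x)|<+\infty$ and the inf-convolution $(f\oplus g)(x):=\inf\{f(y)+g(z): y,z\in X,\ yz=x\}$, for which it is a monoid with identity element $d(e,\cdot)$ ($e$ being the identity of $X$). A monoid (group) isometric isomorphism is a monoid (group) isomorphism that is also a surjective isometry. $Aut_{Iso}(\mathcal{K}(X))$ is the group of all isometric automorphisms of the monoid $(\mathcal{K}(X),\oplus,d_\infty)$, and $Aut_{Iso}(X)$ is the group of all isometric automorphisms of the group $(X,d)$. *)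

theory Defs
  imports "HOL-Analysis.Analysis" "HOL-Algebra.Bij"
begin

locale metric_invariant_group = group G + Metric_space "carrier G" d
  for G (structure) and d +
  assumes left_invariant:
      "\<lbrakk>x \<in> carrier G; y \<in> carrier G; z \<in> carrier G\<rbrakk> \<Longrightarrow> d (x \<otimes> y) (x \<otimes> z) = d y z"
    and right_invariant:
      "\<lbrakk>x \<in> carrier G; y \<in> carrier G; z \<in> carrier G\<rbrakk> \<Longrightarrow> d (y \<otimes> x) (z \<otimes> x) = d y z"

locale complete_metric_invariant_group = metric_invariant_group +
  assumes complete: mcomplete

text \<open>
  A function on the carrier is represented by its extensional representative, so that
  equality of such functions is equality on the carrier.
\<close>

definition Katetov_maps :: "'a set \<Rightarrow> ('a \<Rightarrow> 'a \<Rightarrow> real) \<Rightarrow> ('a \<Rightarrow> real) set" where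
  "Katetov_maps M d =
    {f \<in> extensional M. \<forall>x\<in>M. \<forall>y\<in>M. \<bar>f x - f y\<bar> \<le> d x y \<and> d x y \<le> f x + f y}"

definition sup_dist :: "'a set \<Rightarrow> ('a \<Rightarrow> real) \<Rightarrow> ('a \<Rightarrow> real) \<Rightarrow> real" where
  "sup_dist M f g = (SUP x\<in>M. \<bar>f x - g x\<bar>)"

definition inf_conv ::
    "('a, 'm) monoid_scheme \<Rightarrow> ('a \<Rightarrow> real) \<Rightarrow> ('a \<Rightarrow> real) \<Rightarrow> 'a \<Rightarrow> real" where
  "inf_conv G f g =
    (\<lambda>x\<in>carrier G. Inf {f y + g z |y z. y \<in> carrier G \<and> z \<in> carrier G \<and> y \<otimes>\<^bsub>G\<^esub> z = x})"

definition Katetov_monoid ::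
    "('a, 'm) monoid_scheme \<Rightarrow> ('a \<Rightarrow> 'a \<Rightarrow> real) \<Rightarrow> ('a \<Rightarrow> real) monoid" where
  "Katetov_monoid G d =
    \<lparr>carrier = Katetov_maps (carrier G) d,
     mult = inf_conv G,
     one = (\<lambda>x\<in>carrier G. d \<one>\<^bsub>G\<^esub> x)\<rparr>"

text \<open>
  \<^const>\<open>iso\<close> asks for a multiplicative bijection of the carriers only; preservation of the
  unit is added since it is part of being a monoid homomorphism.
\<close>

definition isometric_iso ::
    "('a, 'm) monoid_scheme \<Rightarrow> ('a \<Rightarrow> 'a \<Rightarrow> real) \<Rightarrow>
     ('b, 'n) monoid_scheme \<Rightarrow> ('b \<Rightarrow> 'b \<Rightarrow> real) \<Rightarrow> ('a \<Rightarrow> 'b) \<Rightarrow> bool" where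
  "isometric_iso G d H d' h \<longleftrightarrow>
    h \<in> iso G H \<and> h \<one>\<^bsub>G\<^esub> = \<one>\<^bsub>H\<^esub> \<and>
    (\<forall>x\<in>carrier G. \<forall>y\<in>carrier G. d' (h x) (h y) = d x y)"

definition AutIso ::
    "('a, 'm) monoid_scheme \<Rightarrow> ('a \<Rightarrow> 'a \<Rightarrow> real) \<Rightarrow> ('a \<Rightarrow> 'a) monoid" where
  "AutIso G d =
    BijGroup (carrier G) \<lparr>carrier := {h \<in> Bij (carrier G). isometric_iso G d G d h}\<rparr>"

lemma (in monoid) group_AutIso: "group (AutIso G d)"
proof -
  let ?B = "BijGroup (carrier G)"
  let ?A = "{h \<in> Bij (carrier G). isometric_iso G d G d h}"
  interpret B: group ?B by (rule group_BijGroup)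
  have closed: "compose (carrier G) h k \<in> ?A" if "h \<in> ?A" "k \<in> ?A" for h k
  proof -
    have "compose (carrier G) h k \<in> Bij (carrier G)"
      using that by (simp add: compose_Bij)
    then show ?thesis
      using that by (auto simp: isometric_iso_def iso_def hom_def Bij_def compose_def Pi_iff)
  qed
  have inverse: "restrict (inv_into (carrier G) h) (carrier G) \<in> ?A" if h: "h \<in> ?A" for h
  proof -
    let ?k = "restrict (inv_into (carrier G) h) (carrier G)"
    have k: "?k \<in> Bij (carrier G)"
      using h by (simp add: restrict_inv_into_Bij)
    have inj: "inj_on h (carrier G)" and surj: "h ` carrier G = carrier G"
      using h by (auto simp: Bij_def bij_betw_def)
    have kh: "inv_into (carrier G) h (h x) = x" if "x \<in> carrier G" for x
      using inj that by simp
    have "?k x \<in> carrier G" if "x \<in> carrier G" for x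
      using k that by (auto simp: Bij_def bij_betw_def)
    moreover have "?k (x \<otimes> y) = ?k x \<otimes> ?k y \<and> d (?k x) (?k y) = d x y"
      if xy: "x \<in> carrier G" "y \<in> carrier G" for x y
    proof -
      obtain a b where ab: "a \<in> carrier G" "b \<in> carrier G" "x = h a" "y = h b"
        using xy surj by (metis imageE)
      have hab: "h a \<otimes> h b = h (a \<otimes> b)" "d (h a) (h b) = d a b"
        using h ab by (simp_all add: isometric_iso_def iso_def hom_def)
      have kh': "?k (h c) = c" if "c \<in> carrier G" for c
        using kh[OF that] imageI[OF that, of h] unfolding surj by simp
      have "?k (x \<otimes> y) = a \<otimes> b"
        unfolding ab(3,4) hab(1) using ab(1,2) by (intro kh') simp
      moreover have "?k x = a" "?k y = b"
        unfolding ab(3,4) using ab(1,2) by (simp_all only: kh')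
      ultimately show ?thesis
        using hab(2) ab(3,4) by simp
    qed
    moreover have "?k \<one> = \<one>"
      using h kh[of \<one>] by (simp add: isometric_iso_def)
    ultimately show ?thesis
      using k by (auto simp: isometric_iso_def iso_def hom_def Bij_def)
  qed
  have "subgroup ?A ?B"
  proof (rule subgroup.intro)
    show "?A \<subseteq> carrier ?B"
      by (auto simp: BijGroup_def)
    show "h \<otimes>\<^bsub>?B\<^esub> k \<in> ?A" if "h \<in> ?A" "k \<in> ?A" for h k
      using that closed[OF that] by (simp add: BijGroup_def)
    show "\<one>\<^bsub>?B\<^esub> \<in> ?A"
      using id_Bij[of "carrier G"]
      by (auto simp: BijGroup_def isometric_iso_def iso_def hom_def Bij_def)
    show "inv\<^bsub>?B\<^esub> h \<in> ?A" if "h \<in> ?A" for h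
      using that inverse[OF that] by (simp add: inv_BijGroup)
  qed
  then show ?thesis
    unfolding AutIso_def by (rule B.subgroup_imp_group)
qed

context metric_invariant_group
begin

lemma Katetov_nonneg:
  assumes "f \<in> Katetov_maps (carrier G) d" "x \<in> carrier G"
  shows "0 \<le> f x"
proof -
  have "d x x \<le> f x + f x"
    using assms unfolding Katetov_maps_def by blast
  then show ?thesis
    using assms by simp
qed

lemma Katetov_lipschitz:
  assumes "f \<in> Katetov_maps (carrier G) d" "x \<in> carrier G" "y \<in> carrier G"
  shows "f x \<le> f y + d x y"
  using assms by (fastforce simp: Katetov_maps_def)

lemma bdd_above_sup_dist:
  assumes f: "f \<in> Katetov_maps (carrier G) d" and g: "g \<in> Katetov_maps (carrier G) d"
  shows "bdd_above ((\<lambda>x. \<bar>f x - g x\<bar>) ` carrier G)"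
proof (rule bdd_aboveI2)
  fix x assume x: "x \<in> carrier G"
  have *: "f x \<le> f \<one> + d x \<one>" "g x \<le> g \<one> + d x \<one>"
    using x f g by (auto intro: Katetov_lipschitz)
  have "d x \<one> \<le> f x + f \<one>" "d x \<one> \<le> g x + g \<one>"
    using x f g by (auto simp: Katetov_maps_def)
  with * show "\<bar>f x - g x\<bar> \<le> f \<one> + g \<one>"
    by linarith
qed

lemma inf_conv_le:
  assumes "f \<in> Katetov_maps (carrier G) d" "g \<in> Katetov_maps (carrier G) d"
    and "y \<in> carrier G" "z \<in> carrier G"
  shows "inf_conv G f g (y \<otimes> z) \<le> f y + g z"
proof -
  let ?S = "{f u + g v |u v. u \<in> carrier G \<and> v \<in> carrier G \<and> u \<otimes> v = y \<otimes> z}"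
  have "bdd_below ?S"
    by (rule bdd_belowI[of _ 0]) (use assms Katetov_nonneg in fastforce)
  moreover have "f y + g z \<in> ?S"
    using assms by blast
  ultimately have "Inf ?S \<le> f y + g z"
    by (rule cInf_lower[rotated])
  then show ?thesis
    using assms by (simp add: inf_conv_def)
qed

lemma inf_conv_greatest:
  assumes "x \<in> carrier G"
    and "\<And>y z. \<lbrakk>y \<in> carrier G; z \<in> carrier G; y \<otimes> z = x\<rbrakk> \<Longrightarrow> c \<le> f y + g z"
  shows "c \<le> inf_conv G f g x"
proof -
  have "f \<one> + g x \<in> {f u + g v |u v. u \<in> carrier G \<and> v \<in> carrier G \<and> u \<otimes> v = x}"
    using assms(1) by force
  then have "c \<le> Inf {f u + g v |u v. u \<in> carrier G \<and> v \<in> carrier G \<and> u \<otimes> v = x}"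
    by (intro cInf_greatest) (use assms(2) in blast)+
  then show ?thesis
    using assms(1) by (simp add: inf_conv_def)
qed

lemma inf_conv_Katetov:
  assumes f: "f \<in> Katetov_maps (carrier G) d" and g: "g \<in> Katetov_maps (carrier G) d"
  shows "inf_conv G f g \<in> Katetov_maps (carrier G) d"
proof -
  let ?h = "inf_conv G f g"
  have lip: "?h x \<le> ?h x' + d x x'" if x: "x \<in> carrier G" "x' \<in> carrier G" for x x'
  proof -
    have "?h x - d x x' \<le> f y + g z"
      if yz: "y \<in> carrier G" "z \<in> carrier G" "y \<otimes> z = x'" for y z
    proof -
      let ?u = "x \<otimes> inv z"
      have u: "?u \<in> carrier G" "?u \<otimes> z = x"
        using x yz by (auto simp: m_assoc)
      have "?h x \<le> f ?u + g z"
        using inf_conv_le[OF f g u(1) yz(2)] u by simp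
      moreover have "d ?u y = d x x'"
        using right_invariant[of z ?u y] u yz by simp
      then have "f ?u \<le> f y + d x x'"
        using Katetov_lipschitz[OF f u(1) yz(1)] by simp
      ultimately show ?thesis
        by linarith
    qed
    then have "?h x - d x x' \<le> ?h x'"
      using x by (intro inf_conv_greatest)
    then show ?thesis
      by linarith
  qed
  have tri: "d x x' \<le> ?h x + ?h x'" if x: "x \<in> carrier G" "x' \<in> carrier G" for x x'
  proof -
    have "d x x' - ?h x' \<le> ?h x"
    proof (rule inf_conv_greatest[OF x(1)])
      fix y z assume yz: "y \<in> carrier G" "z \<in> carrier G" "y \<otimes> z = x"
      have "d x x' - (f y + g z) \<le> ?h x'"
      proof (rule inf_conv_greatest[OF x(2)])
        fix y' z' assume yz': "y' \<in> carrier G" "z' \<in> carrier G" "y' \<otimes> z' = x'"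
        have "d (y \<otimes> z) (y' \<otimes> z') \<le> d (y \<otimes> z) (y \<otimes> z') + d (y \<otimes> z') (y' \<otimes> z')"
          using yz(1,2) yz'(1,2) by (intro triangle m_closed)
        also have "\<dots> = d z z' + d y y'"
          using yz(1,2) yz'(1,2) by (simp add: left_invariant right_invariant)
        also have "\<dots> \<le> (g z + g z') + (f y + f y')"
          using f g yz yz' by (auto simp: Katetov_maps_def intro!: add_mono)
        finally show "d x x' - (f y + g z) \<le> f y' + g z'"
          unfolding yz(3) yz'(3) by linarith
      qed
      then show "d x x' - ?h x' \<le> f y + g z"
        by linarith
    qed
    then show ?thesis
      by linarith
  qed
  have "\<bar>?h x - ?h x'\<bar> \<le> d x x'" if "x \<in> carrier G" "x' \<in> carrier G" for x x'
    using lip[OF that] lip[OF that(2,1)] commute[of x x'] by linarith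
  then show ?thesis
    using tri by (auto simp: Katetov_maps_def inf_conv_def)
qed

lemma dist_one_Katetov: "(\<lambda>x\<in>carrier G. d \<one> x) \<in> Katetov_maps (carrier G) d"
proof -
  have "\<bar>d \<one> x - d \<one> y\<bar> \<le> d x y \<and> d x y \<le> d \<one> x + d \<one> y"
    if "x \<in> carrier G" "y \<in> carrier G" for x y
    using that triangle[of \<one> x y] triangle[of \<one> y x] triangle[of x \<one> y]
      commute[of x y] commute[of x \<one>] by auto
  then show ?thesis
    by (auto simp: Katetov_maps_def)
qed

lemma inf_conv_assoc:
  assumes f: "f \<in> Katetov_maps (carrier G) d" and g: "g \<in> Katetov_maps (carrier G) d"
    and h: "h \<in> Katetov_maps (carrier G) d"
  shows "inf_conv G (inf_conv G f g) h = inf_conv G f (inf_conv G g h)"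
proof (rule extensionalityI)
  note fg = inf_conv_Katetov[OF f g] and gh = inf_conv_Katetov[OF g h]
  fix x assume x: "x \<in> carrier G"
  show "inf_conv G (inf_conv G f g) h x = inf_conv G f (inf_conv G g h) x"
  proof (rule antisym)
    show "inf_conv G (inf_conv G f g) h x \<le> inf_conv G f (inf_conv G g h) x"
    proof (rule inf_conv_greatest[OF x])
      fix a v assume av: "a \<in> carrier G" "v \<in> carrier G" "a \<otimes> v = x"
      have "inf_conv G (inf_conv G f g) h x - f a \<le> inf_conv G g h v"
      proof (rule inf_conv_greatest[OF av(2)])
        fix b c assume bc: "b \<in> carrier G" "c \<in> carrier G" "b \<otimes> c = v"
        have "inf_conv G (inf_conv G f g) h x \<le> inf_conv G f g (a \<otimes> b) + h c"
          using inf_conv_le[OF fg h, of "a \<otimes> b" c] av bc by (simp add: m_assoc)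
        moreover have "inf_conv G f g (a \<otimes> b) \<le> f a + g b"
          using inf_conv_le[OF f g] av bc by simp
        ultimately show "inf_conv G (inf_conv G f g) h x - f a \<le> g b + h c"
          by linarith
      qed
      then show "inf_conv G (inf_conv G f g) h x \<le> f a + inf_conv G g h v"
        by linarith
    qed
    show "inf_conv G f (inf_conv G g h) x \<le> inf_conv G (inf_conv G f g) h x"
    proof (rule inf_conv_greatest[OF x])
      fix u c assume uc: "u \<in> carrier G" "c \<in> carrier G" "u \<otimes> c = x"
      have "inf_conv G f (inf_conv G g h) x - h c \<le> inf_conv G f g u"
      proof (rule inf_conv_greatest[OF uc(1)])
        fix a b assume ab: "a \<in> carrier G" "b \<in> carrier G" "a \<otimes> b = u"
        have "a \<otimes> (b \<otimes> c) = x"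
          using ab uc m_assoc[of a b c] by simp
        then have "inf_conv G f (inf_conv G g h) x \<le> f a + inf_conv G g h (b \<otimes> c)"
          using inf_conv_le[OF f gh, of a "b \<otimes> c"] ab uc by simp
        moreover have "inf_conv G g h (b \<otimes> c) \<le> g b + h c"
          using inf_conv_le[OF g h] ab uc by simp
        ultimately show "inf_conv G f (inf_conv G g h) x - h c \<le> f a + g b"
          by linarith
      qed
      then show "inf_conv G f (inf_conv G g h) x \<le> inf_conv G f g u + h c"
        by linarith
    qed
  qed
qed (auto simp: inf_conv_def)

lemma inf_conv_dist_one:
  assumes f: "f \<in> Katetov_maps (carrier G) d"
  shows "inf_conv G (\<lambda>x\<in>carrier G. d \<one> x) f = f"
    and "inf_conv G f (\<lambda>x\<in>carrier G. d \<one> x) = f"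
proof -
  let ?e = "\<lambda>x\<in>carrier G. d \<one> x"
  note e = dist_one_Katetov
  have ext: "f \<in> extensional (carrier G)"
    using f by (simp add: Katetov_maps_def)
  show "inf_conv G ?e f = f"
  proof (rule extensionalityI[OF _ ext])
    fix x assume x: "x \<in> carrier G"
    have "f x \<le> inf_conv G ?e f x"
    proof (rule inf_conv_greatest[OF x])
      fix y z assume yz: "y \<in> carrier G" "z \<in> carrier G" "y \<otimes> z = x"
      have "d x z = d y \<one>"
        using right_invariant[of z y \<one>] yz by simp
      then show "f x \<le> ?e y + f z"
        using Katetov_lipschitz[OF f x yz(2)] yz commute[of y \<one>] by simp
    qed
    moreover have "inf_conv G ?e f x \<le> f x"
      using inf_conv_le[OF e f, of \<one> x] x by simp
    ultimately show "inf_conv G ?e f x = f x"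
      by (rule antisym[rotated])
  qed (simp add: inf_conv_def)
  show "inf_conv G f ?e = f"
  proof (rule extensionalityI[OF _ ext])
    fix x assume x: "x \<in> carrier G"
    have "f x \<le> inf_conv G f ?e x"
    proof (rule inf_conv_greatest[OF x])
      fix y z assume yz: "y \<in> carrier G" "z \<in> carrier G" "y \<otimes> z = x"
      have "d x y = d z \<one>"
        using left_invariant[of y z \<one>] yz by simp
      then show "f x \<le> f y + ?e z"
        using Katetov_lipschitz[OF f x yz(1)] yz commute[of z \<one>] by simp
    qed
    moreover have "inf_conv G f ?e x \<le> f x"
      using inf_conv_le[OF f e, of x \<one>] x by simp
    ultimately show "inf_conv G f ?e x = f x"
      by (rule antisym[rotated])
  qed (simp add: inf_conv_def)
qed

lemma monoid_Katetov_monoid: "monoid (Katetov_monoid G d)"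
  by (rule monoidI)
    (simp_all add: Katetov_monoid_def inf_conv_Katetov dist_one_Katetov inf_conv_assoc
      inf_conv_dist_one)

end

end

theory Submission
  imports Defs
begin

text \<open>
  The maps \<open>d(x, \<cdot>)\<close> satisfy \<open>d\<^sub>\<infinity>(f, d(x, \<cdot>)) = f(x)\<close> for every Katetov map \<open>f\<close>, and by
  completeness they are exactly the invertible elements of the monoid: if \<open>f \<oplus> g\<close> is the unit,
  then \<open>inf f = 0\<close>, and a minimizing sequence of a Katetov map is Cauchy. A monoid isomorphism
  permutes invertible elements, so it induces a bijection \<open>T\<close> of the groups, and the distance
  formula turns isometry into \<open>(\<Phi> f)(T x) = f(x)\<close>.
\<close>

section \<open>Point maps in a metric invariant group\<close>

context metric_invariant_group
begin

text \<open>The Kuratowski embedding of the group into its Katetov maps; at the identity it gives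
  the unit of the monoid.\<close>

definition point_map :: "'a \<Rightarrow> 'a \<Rightarrow> real" where
  "point_map x = (\<lambda>y\<in>carrier G. d x y)"

lemma point_map_Katetov: "x \<in> carrier G \<Longrightarrow> point_map x \<in> Katetov_maps (carrier G) d"
proof -
  assume x: "x \<in> carrier G"
  have "\<bar>d x y - d x z\<bar> \<le> d y z \<and> d y z \<le> d x y + d x z"
    if "y \<in> carrier G" "z \<in> carrier G" for y z
    using that x triangle[of x y z] triangle[of x z y] triangle[of y x z]
      commute[of y z] commute[of y x] by auto
  then show ?thesis
    by (auto simp: Katetov_maps_def point_map_def)
qed

text \<open>The Lipschitz bound and the triangle-type bound of a Katetov map together say that
  \<open>f y\<close> and \<open>d x y\<close> differ by at most \<open>f x\<close>. At
  \<open>y = x\<close> this bound is attained, so the supremum is a maximum. Values of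
  \<open>f\<close> can thus be read off from distances alone.\<close>

lemma sup_dist_point_map:
  assumes f: "f \<in> Katetov_maps (carrier G) d" and x: "x \<in> carrier G"
  shows "sup_dist (carrier G) f (point_map x) = f x"
  unfolding sup_dist_def
proof (rule cSup_eq_maximum)
  have "f x = \<bar>f x - point_map x x\<bar>"
    using x Katetov_nonneg[OF f x] by (simp add: point_map_def)
  then show "f x \<in> (\<lambda>y. \<bar>f y - point_map x y\<bar>) ` carrier G"
    using x by blast
next
  fix r assume "r \<in> (\<lambda>y. \<bar>f y - point_map x y\<bar>) ` carrier G"
  then obtain y where y: "y \<in> carrier G" "r = \<bar>f y - d x y\<bar>"
    by (auto simp: point_map_def)
  have "d x y \<le> f x + f y"
    using f x y by (auto simp: Katetov_maps_def)
  then show "r \<le> f x"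
    using Katetov_lipschitz[OF f y(1) x] y commute[of x y] by simp
qed

text \<open>The factorization of \<open>z\<close> with first factor \<open>x\<close> already gives
  the claimed value, by left invariance. No other factorization into \<open>u\<close> and
  \<open>v\<close> does better: apply the triangle inequality through the product of
  \<open>x\<close> and \<open>v\<close>, then both invariances.\<close>

lemma point_map_mult:
  assumes x: "x \<in> carrier G" and y: "y \<in> carrier G"
  shows "inf_conv G (point_map x) (point_map y) = point_map (x \<otimes> y)"
proof (rule extensionalityI)
  fix z assume z: "z \<in> carrier G"
  show "inf_conv G (point_map x) (point_map y) z = point_map (x \<otimes> y) z"
  proof (rule antisym)
    let ?v = "inv x \<otimes> z"
    have v: "?v \<in> carrier G" "x \<otimes> ?v = z"
      using x z by (auto simp: m_assoc[symmetric])
    have "d y ?v = d (x \<otimes> y) z"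
      using left_invariant[of x y ?v] x y v by simp
    then show "inf_conv G (point_map x) (point_map y) z \<le> point_map (x \<otimes> y) z"
      using inf_conv_le[OF point_map_Katetov[OF x] point_map_Katetov[OF y] x v(1)] x y z v
      by (simp add: point_map_def)
    show "point_map (x \<otimes> y) z \<le> inf_conv G (point_map x) (point_map y) z"
    proof (rule inf_conv_greatest[OF z])
      fix u v assume uv: "u \<in> carrier G" "v \<in> carrier G" "u \<otimes> v = z"
      have "d (x \<otimes> y) (u \<otimes> v) \<le> d (x \<otimes> y) (x \<otimes> v) + d (x \<otimes> v) (u \<otimes> v)"
        using x y uv by (intro triangle) auto
      also have "\<dots> = d y v + d x u"
        using x y uv(1,2) by (simp add: left_invariant right_invariant)
      finally show "point_map (x \<otimes> y) z \<le> point_map x u + point_map y v"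
        using x y z uv by (simp add: point_map_def)
    qed
  qed
qed (auto simp: inf_conv_def point_map_def)

lemma inj_on_point_map: "inj_on point_map (carrier G)"
proof (rule inj_onI)
  fix x y assume xy: "x \<in> carrier G" "y \<in> carrier G" and eq: "point_map x = point_map y"
  have "d x y = d y y"
    using fun_cong[OF eq, of y] xy by (simp add: point_map_def)
  then show "x = y"
    using xy by simp
qed

text \<open>At a zero \<open>y\<close> the two Katetov inequalities pinch \<open>f z\<close> from
  below and from above by \<open>d y z\<close>.\<close>

lemma Katetov_zero_imp_point_map:
  assumes f: "f \<in> Katetov_maps (carrier G) d" and y: "y \<in> carrier G" and 0: "f y = 0"
  shows "f = point_map y"
proof (rule extensionalityI)
  fix z assume z: "z \<in> carrier G"
  have "d y z \<le> f y + f z"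
    using f y z by (auto simp: Katetov_maps_def)
  then show "f z = point_map y z"
    using Katetov_lipschitz[OF f z y] z 0 commute[of y z] by (simp add: point_map_def)
qed (use f in \<open>auto simp: Katetov_maps_def point_map_def\<close>)

lemma point_map_Units:
  assumes x: "x \<in> carrier G"
  shows "point_map x \<in> Units (Katetov_monoid G d)"
proof -
  have "point_map (inv x) \<in> Katetov_maps (carrier G) d"
    using x by (simp add: point_map_Katetov)
  moreover have "point_map \<one> = (\<lambda>y\<in>carrier G. d \<one> y)"
    by (simp add: point_map_def)
  ultimately show ?thesis
    using x by (auto simp: Units_def Katetov_monoid_def point_map_Katetov point_map_mult
        intro!: bexI[of _ "point_map (inv x)"])
qed

end

section \<open>Completeness and the invertible elements\<close>

context complete_metric_invariant_group
begin

text \<open>Since \<open>d (s n) (s m)\<close> is at most \<open>f (s n) + f (s m)\<close>, points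
  where \<open>f\<close> tends to 0 form a Cauchy sequence. The Lipschitz bound carries the value 0
  over to the limit.\<close>

lemma Katetov_attains_zero:
  assumes f: "f \<in> Katetov_maps (carrier G) d"
    and small: "\<And>e. 0 < e \<Longrightarrow> \<exists>y\<in>carrier G. f y < e"
  obtains y where "y \<in> carrier G" "f y = 0"
proof -
  have "\<forall>n. \<exists>y\<in>carrier G. f y < inverse (Suc n)"
    using small by simp
  then obtain s where s: "\<And>n. s n \<in> carrier G" "\<And>n. f (s n) < inverse (Suc n)"
    by metis
  have s_small: "\<exists>N. \<forall>n\<ge>N. f (s n) < e" if "0 < e" for e
  proof -
    obtain N where N: "inverse (Suc N) < e"
      using reals_Archimedean[OF \<open>0 < e\<close>] by blast
    have "f (s n) < e" if "N \<le> n" for n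
    proof -
      have "inverse (real (Suc n)) \<le> inverse (real (Suc N))"
        using that by (intro le_imp_inverse_le) auto
      then show ?thesis
        using s(2)[of n] N by linarith
    qed
    then show ?thesis by blast
  qed
  have "MCauchy s"
    unfolding MCauchy_def
  proof (intro conjI allI impI)
    show "range s \<subseteq> carrier G"
      using s by auto
    fix e :: real assume "0 < e"
    then obtain N where N: "\<forall>n\<ge>N. f (s n) < e/2"
      using s_small[of "e/2"] by auto
    have "d (s n) (s m) < e" if "N \<le> n" "N \<le> m" for n m
    proof -
      have "d (s n) (s m) \<le> f (s n) + f (s m)"
        using f s(1) unfolding Katetov_maps_def by blast
      moreover have "f (s n) < e/2" "f (s m) < e/2"
        using N that by auto
      ultimately show ?thesis by linarith
    qed
    then show "\<exists>N. \<forall>n m. N \<le> n \<longrightarrow> N \<le> m \<longrightarrow> d (s n) (s m) < e"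
      by blast
  qed
  then obtain y where lim: "limitin mtopology s y sequentially"
    using complete unfolding mcomplete_def by blast
  then have y: "y \<in> carrier G"
    using limitin_mspace by blast
  \<comment> \<open>The summand \<open>0\<close> gives the bound the shape that
    \<open>field_le_epsilon\<close> expects.\<close>
  have "f y \<le> 0 + e" if "0 < e" for e
  proof -
    have e: "0 < e/2"
      using that by simp
    then obtain N where N: "\<forall>n\<ge>N. f (s n) < e/2"
      using s_small by blast
    obtain M where M: "\<forall>n\<ge>M. d (s n) y < e/2"
      using lim e unfolding limit_metric_sequentially by blast
    have "f (s (max M N)) < e/2" "d (s (max M N)) y < e/2"
      using N M by auto
    then show ?thesis
      using Katetov_lipschitz[OF f y s(1), of "max M N"] commute[of y "s (max M N)"] by linarith
  qed
  then have "f y \<le> 0"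
    by (rule field_le_epsilon)
  then show thesis
    using that y Katetov_nonneg[OF f y] by fastforce
qed

lemma Units_Katetov_monoid: "Units (Katetov_monoid G d) = point_map ` carrier G"
proof (intro equalityI subsetI)
  fix f assume "f \<in> Units (Katetov_monoid G d)"
  then obtain g where f: "f \<in> Katetov_maps (carrier G) d" and g: "g \<in> Katetov_maps (carrier G) d"
    and fg: "inf_conv G f g = (\<lambda>x\<in>carrier G. d \<one> x)"
    by (auto simp: Units_def Katetov_monoid_def)
  \<comment> \<open>If \<open>f\<close> were at least \<open>e\<close> everywhere, then,
    \<open>g\<close> being non-negative, so would be the convolution at the identity; but the unit
    vanishes there.\<close>
  have "\<exists>y\<in>carrier G. f y < e" if "0 < e" for e
  proof (rule ccontr)
    assume "\<not> (\<exists>y\<in>carrier G. f y < e)"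
    then have "e \<le> f y" if "y \<in> carrier G" for y
      using that by (meson not_le)
    then have "e \<le> f y + g z" if "y \<in> carrier G" "z \<in> carrier G" for y z
      using Katetov_nonneg[OF g that(2)] that(1) by (simp add: add_increasing2)
    then have "e \<le> inf_conv G f g \<one>"
      by (intro inf_conv_greatest) auto
    then show False
      using that by (simp add: fg)
  qed
  then obtain y where "y \<in> carrier G" "f y = 0"
    using Katetov_attains_zero[OF f] by blast
  then show "f \<in> point_map ` carrier G"
    using Katetov_zero_imp_point_map[OF f] by blast
qed (use point_map_Units in blast)

end

text \<open>Injectivity makes \<open>h\<close> reflect, and not only preserve, the equations that
  define an inverse; surjectivity lets the inverses required in \<open>H\<close> be sought among
  images of elements of \<open>G\<close>.\<close>

lemma iso_image_Units:
  assumes "monoid G" and h: "h \<in> iso G H" and one: "h \<one>\<^bsub>G\<^esub> = \<one>\<^bsub>H\<^esub>"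
  shows "h ` Units G = Units H"
proof -
  interpret G: monoid G by fact
  have bij: "bij_betw h (carrier G) (carrier H)"
    and mult: "\<And>x y. \<lbrakk>x \<in> carrier G; y \<in> carrier G\<rbrakk> \<Longrightarrow> h (x \<otimes>\<^bsub>G\<^esub> y) = h x \<otimes>\<^bsub>H\<^esub> h y"
    using h by (auto simp: iso_def hom_def)
  have unit_iff: "h y \<otimes>\<^bsub>H\<^esub> h x = \<one>\<^bsub>H\<^esub> \<longleftrightarrow> y \<otimes>\<^bsub>G\<^esub> x = \<one>\<^bsub>G\<^esub>"
    if "x \<in> carrier G" "y \<in> carrier G" for x y
    using that mult[OF that(2,1)] one bij_betw_imp_inj_on[OF bij]
    by (metis G.m_closed G.one_closed inj_onD)
  have "Units H = h ` {x \<in> carrier G. \<exists>y\<in>carrier G. h y \<otimes>\<^bsub>H\<^esub> h x = \<one>\<^bsub>H\<^esub> \<and> h x \<otimes>\<^bsub>H\<^esub> h y = \<one>\<^bsub>H\<^esub>}"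
    unfolding Units_def bij_betw_imp_surj_on[OF bij, symmetric] by blast
  also have "\<dots> = h ` Units G"
    unfolding Units_def using unit_iff by (intro image_cong) auto
  finally show ?thesis ..
qed

section \<open>Transport of Katetov maps along a group isometry\<close>

locale metric_invariant_group_iso =
  X: metric_invariant_group X d + Y: metric_invariant_group Y d'
  for X (structure) and d and Y (structure) and d' +
  fixes T
  assumes iso: "isometric_iso X d Y d' T"
begin

text \<open>\<open>compose\<close> makes the result extensional on \<open>carrier Y\<close>, as
  membership in \<open>Katetov_maps\<close> demands.\<close>

abbreviation push where
  "push f \<equiv> compose (carrier Y) f (inv_into (carrier X) T)"

lemma bij: "bij_betw T (carrier X) (carrier Y)"
  using iso by (simp add: isometric_iso_def iso_def)

lemma T_image: "T ` carrier X = carrier Y"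
  using bij by (simp add: bij_betw_def)

text \<open>Together with \<open>image_Y\<close> this moves statements over \<open>carrier Y\<close>
  to arguments of the form \<open>T x\<close>, where \<open>push_apply\<close> removes the inverse
  of \<open>T\<close>.\<close>

lemma ball_Y: "(\<forall>y\<in>carrier Y. P y) \<longleftrightarrow> (\<forall>x\<in>carrier X. P (T x))"
  unfolding T_image[symmetric] by blast

lemma image_Y: "p ` carrier Y = (\<lambda>x. p (T x)) ` carrier X"
  unfolding T_image[symmetric] by (rule image_image)

lemma T_closed: "x \<in> carrier X \<Longrightarrow> T x \<in> carrier Y"
  using bij by (rule bij_betw_apply)

lemma T_dist: "\<lbrakk>x \<in> carrier X; y \<in> carrier X\<rbrakk> \<Longrightarrow> d' (T x) (T y) = d x y"
  using iso by (simp add: isometric_iso_def)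

lemma T_mult: "\<lbrakk>x \<in> carrier X; y \<in> carrier X\<rbrakk> \<Longrightarrow> T (x \<otimes>\<^bsub>X\<^esub> y) = T x \<otimes>\<^bsub>Y\<^esub> T y"
  using iso by (simp add: isometric_iso_def iso_def hom_def)

lemma T_mult_eq_iff:
  "\<lbrakk>x \<in> carrier X; y \<in> carrier X; z \<in> carrier X\<rbrakk> \<Longrightarrow>
    T x \<otimes>\<^bsub>Y\<^esub> T y = T z \<longleftrightarrow> x \<otimes>\<^bsub>X\<^esub> y = z"
  using T_mult bij_betw_imp_inj_on[OF bij] by (metis X.m_closed inj_onD)

lemma push_apply: "x \<in> carrier X \<Longrightarrow> push f (T x) = f x"
  using bij T_closed by (simp add: compose_def bij_betw_inv_into_left)

text \<open>By surjectivity of \<open>T\<close>, an extensional function on \<open>carrier Y\<close>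
  is determined by its values at the points \<open>T x\<close>. Pushes can thus be identified
  without handling \<open>inv_into\<close>.\<close>

lemma push_eqI:
  assumes "g \<in> extensional (carrier Y)" and "\<And>x. x \<in> carrier X \<Longrightarrow> g (T x) = f x"
  shows "g = push f"
proof (rule extensionalityI[OF assms(1)])
  fix y assume "y \<in> carrier Y"
  then obtain x where "x \<in> carrier X" "y = T x"
    using T_image by auto
  then show "g y = push f y"
    by (simp add: assms(2) push_apply)
qed auto

lemma push_Katetov:
  assumes "f \<in> Katetov_maps (carrier X) d"
  shows "push f \<in> Katetov_maps (carrier Y) d'"
  using assms by (simp add: Katetov_maps_def ball_Y push_apply T_dist)

lemma bij_betw_push:
  "bij_betw push (Katetov_maps (carrier X) d) (Katetov_maps (carrier Y) d')"
proof (rule bij_betw_imageI)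
  show "inj_on push (Katetov_maps (carrier X) d)"
  proof (rule inj_onI)
    fix f g assume fg: "f \<in> Katetov_maps (carrier X) d" "g \<in> Katetov_maps (carrier X) d"
      and eq: "push f = push g"
    show "f = g"
    proof (rule extensionalityI)
      show "f \<in> extensional (carrier X)" "g \<in> extensional (carrier X)"
        using fg by (simp_all add: Katetov_maps_def)
      show "f x = g x" if "x \<in> carrier X" for x
        using fun_cong[OF eq, of "T x"] that by (simp add: push_apply)
    qed
  qed
  show "push ` Katetov_maps (carrier X) d = Katetov_maps (carrier Y) d'"
  proof (intro equalityI subsetI)
    fix g assume g: "g \<in> Katetov_maps (carrier Y) d'"
    \<comment> \<open>The preimage of \<open>g\<close> is its pullback along \<open>T\<close>;
      \<open>T_dist\<close> is used from right to left to turn distances in \<open>X\<close> into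
      distances in \<open>Y\<close>.\<close>
    have "compose (carrier X) g T \<in> Katetov_maps (carrier X) d"
      using g by (auto simp: Katetov_maps_def compose_def T_closed simp flip: T_dist)
    moreover have "g = push (compose (carrier X) g T)"
      using g by (intro push_eqI) (auto simp: Katetov_maps_def compose_def)
    ultimately show "g \<in> push ` Katetov_maps (carrier X) d"
      by blast
  qed (use push_Katetov in blast)
qed

text \<open>\<open>T\<close> matches the factorizations of \<open>x\<close> with those of
  \<open>T x\<close>, and matching factorizations have equal sums, so both infima are taken over the
  same set.\<close>

lemma push_inf_conv: "push (inf_conv X f g) = inf_conv Y (push f) (push g)"
proof (rule push_eqI[symmetric])
  fix x assume x: "x \<in> carrier X"
  have "{push f y + push g z |y z. y \<in> carrier Y \<and> z \<in> carrier Y \<and> y \<otimes>\<^bsub>Y\<^esub> z = T x} =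
      {push f (T y) + push g (T z) |y z. y \<in> carrier X \<and> z \<in> carrier X \<and> T y \<otimes>\<^bsub>Y\<^esub> T z = T x}"
    unfolding T_image[symmetric] by blast
  also have "\<dots> = {f y + g z |y z. y \<in> carrier X \<and> z \<in> carrier X \<and> y \<otimes>\<^bsub>X\<^esub> z = x}"
    using x by (intro Collect_cong) (metis T_mult_eq_iff push_apply)
  finally show "inf_conv Y (push f) (push g) (T x) = inf_conv X f g x"
    using x by (simp add: inf_conv_def T_closed)
qed (simp add: inf_conv_def)

lemma push_sup_dist: "sup_dist (carrier Y) (push f) (push g) = sup_dist (carrier X) f g"
  by (simp add: sup_dist_def image_Y push_apply cong: image_cong_simp)

lemma push_one: "push (\<lambda>x\<in>carrier X. d \<one>\<^bsub>X\<^esub> x) = (\<lambda>y\<in>carrier Y. d' \<one>\<^bsub>Y\<^esub> y)"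
proof (rule push_eqI[symmetric])
  fix x assume x: "x \<in> carrier X"
  have "T \<one>\<^bsub>X\<^esub> = \<one>\<^bsub>Y\<^esub>"
    using iso by (simp add: isometric_iso_def)
  then show "(\<lambda>y\<in>carrier Y. d' \<one>\<^bsub>Y\<^esub> y) (T x) = (\<lambda>x\<in>carrier X. d \<one>\<^bsub>X\<^esub> x) x"
    using x T_dist[OF X.one_closed x] by (simp add: T_closed)
qed simp

text \<open>Agreement with \<open>push\<close> is asked on Katetov maps only, so that this covers
  both an arbitrary \<Phi> and a restricted function as in \<open>AutIso\<close>.\<close>

lemma isometric_iso_push:
  assumes "\<And>f. f \<in> Katetov_maps (carrier X) d \<Longrightarrow> \<Phi> f = push f"
  shows "isometric_iso (Katetov_monoid X d) (sup_dist (carrier X))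
      (Katetov_monoid Y d') (sup_dist (carrier Y)) \<Phi>"
proof -
  have "bij_betw \<Phi> (Katetov_maps (carrier X) d) (Katetov_maps (carrier Y) d')"
    using bij_betw_push assms by (subst bij_betw_cong) auto
  then show ?thesis
    by (auto simp: isometric_iso_def iso_def hom_def Katetov_monoid_def assms push_Katetov
        push_inf_conv push_sup_dist push_one X.inf_conv_Katetov X.dist_one_Katetov)
qed

text \<open>Shows that \<open>T\<close> can be recovered from its push, which gives injectivity of
  the correspondence between automorphisms.\<close>

lemma push_point_map:
  assumes "x \<in> carrier X"
  shows "push (X.point_map x) = Y.point_map (T x)"
  using assms
  by (intro push_eqI[symmetric]) (auto simp: X.point_map_def Y.point_map_def T_closed T_dist)

end

section \<open>From a monoid isomorphism to a group isomorphism\<close>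

lemma metric_invariant_group_isoI:
  assumes "complete_metric_invariant_group X d" and "complete_metric_invariant_group Y d'"
    and "isometric_iso X d Y d' T"
  shows "metric_invariant_group_iso X d Y d' T"
  using assms
  by (simp add: metric_invariant_group_iso_def metric_invariant_group_iso_axioms_def
      complete_metric_invariant_group_def)

lemma Katetov_iso_is_push:
  assumes "complete_metric_invariant_group X d" and "complete_metric_invariant_group Y d'"
    and \<Phi>: "isometric_iso (Katetov_monoid X d) (sup_dist (carrier X))
      (Katetov_monoid Y d') (sup_dist (carrier Y)) \<Phi>"
  obtains T where "isometric_iso X d Y d' T"
    and "\<And>f. f \<in> Katetov_maps (carrier X) d \<Longrightarrow>
      \<Phi> f = compose (carrier Y) f (inv_into (carrier X) T)"
proof -
  interpret X: complete_metric_invariant_group X d by fact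
  interpret Y: complete_metric_invariant_group Y d' by fact
  have bij\<Phi>: "bij_betw \<Phi> (Katetov_maps (carrier X) d) (Katetov_maps (carrier Y) d')"
    and mult: "\<And>f g. \<lbrakk>f \<in> Katetov_maps (carrier X) d; g \<in> Katetov_maps (carrier X) d\<rbrakk>
      \<Longrightarrow> \<Phi> (inf_conv X f g) = inf_conv Y (\<Phi> f) (\<Phi> g)"
    and dist: "\<And>f g. \<lbrakk>f \<in> Katetov_maps (carrier X) d; g \<in> Katetov_maps (carrier X) d\<rbrakk>
      \<Longrightarrow> sup_dist (carrier Y) (\<Phi> f) (\<Phi> g) = sup_dist (carrier X) f g"
    using \<Phi> by (auto simp: isometric_iso_def iso_def hom_def Katetov_monoid_def)
  have "\<Phi> ` X.point_map ` carrier X = Y.point_map ` carrier Y"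
    using iso_image_Units[OF X.monoid_Katetov_monoid, of \<Phi> "Katetov_monoid Y d'"] \<Phi>
    by (simp add: isometric_iso_def X.Units_Katetov_monoid Y.Units_Katetov_monoid)
  moreover have "inj_on \<Phi> (X.point_map ` carrier X)"
    using bij\<Phi> by (auto simp: bij_betw_def X.point_map_Katetov intro: inj_on_subset)
  ultimately have bij_points:
    "bij_betw (\<Phi> \<circ> X.point_map) (carrier X) (Y.point_map ` carrier Y)"
    by (auto simp: bij_betw_def X.inj_on_point_map image_comp intro!: comp_inj_on)
  \<comment> \<open>\<open>T\<close> is the action of \<Phi> on point maps, read as an action on the
    points themselves.\<close>
  define T where "T = inv_into (carrier Y) Y.point_map \<circ> (\<Phi> \<circ> X.point_map)"
  have bij: "bij_betw T (carrier X) (carrier Y)"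
    unfolding T_def
    by (rule bij_betw_trans[OF bij_points bij_betw_inv_into])
      (simp add: bij_betw_def Y.inj_on_point_map)
  have T: "T x \<in> carrier Y" "Y.point_map (T x) = \<Phi> (X.point_map x)" if "x \<in> carrier X" for x
  proof -
    show "T x \<in> carrier Y"
      using bij that by (rule bij_betw_apply)
    show "Y.point_map (T x) = \<Phi> (X.point_map x)"
      using bij_betw_apply[OF bij_points that] by (simp add: T_def f_inv_into_f)
  qed
  \<comment> \<open>Both values are distances to point maps, by \<open>sup_dist_point_map\<close> on
    either side, and \<Phi> preserves these distances.\<close>
  have \<Phi>_apply: "\<Phi> f (T x) = f x" if f: "f \<in> Katetov_maps (carrier X) d" and x: "x \<in> carrier X" for f x
  proof -
    have "\<Phi> f (T x) = sup_dist (carrier Y) (\<Phi> f) (\<Phi> (X.point_map x))"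
      using Y.sup_dist_point_map[OF bij_betw_apply[OF bij\<Phi> f] T(1)[OF x]] T(2)[OF x] by simp
    then show ?thesis
      using f x by (simp add: dist X.point_map_Katetov X.sup_dist_point_map)
  qed
  \<comment> \<open>As point maps are injective and multiplicative, it suffices to compare the point
    maps of both sides, where multiplicativity of \<Phi> applies.\<close>
  have "T (x \<otimes>\<^bsub>X\<^esub> y) = T x \<otimes>\<^bsub>Y\<^esub> T y" if "x \<in> carrier X" "y \<in> carrier X" for x y
    using that
    by (intro inj_onD[OF Y.inj_on_point_map])
      (simp_all add: T Y.point_map_mult[symmetric] X.point_map_mult[symmetric]
        mult X.point_map_Katetov)
  then have hom: "T \<in> hom X Y"
    using T by (auto simp: hom_def)
  \<comment> \<open>This is the evaluation formula \<open>\<Phi>_apply\<close> for the point map of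
    \<open>x\<close>, taken at \<open>y\<close>.\<close>
  have "d' (T x) (T y) = d x y" if "x \<in> carrier X" "y \<in> carrier X" for x y
  proof -
    have "Y.point_map (T x) (T y) = X.point_map x y"
      using \<Phi>_apply[OF X.point_map_Katetov[OF that(1)] that(2)] that by (simp add: T(2))
    then show ?thesis
      using that by (simp add: T(1) X.point_map_def Y.point_map_def)
  qed
  moreover have "T \<one>\<^bsub>X\<^esub> = \<one>\<^bsub>Y\<^esub>"
    using hom_one[OF hom X.group_axioms Y.group_axioms] .
  ultimately have iso: "isometric_iso X d Y d' T"
    using hom bij by (simp add: isometric_iso_def iso_def)
  interpret T: metric_invariant_group_iso X d Y d' T
    using metric_invariant_group_isoI assms(1,2) iso .
  show thesis
  proof (rule that[OF iso])
    fix f assume f: "f \<in> Katetov_maps (carrier X) d"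
    show "\<Phi> f = compose (carrier Y) f (inv_into (carrier X) T)"
      using bij_betw_apply[OF bij\<Phi> f] \<Phi>_apply[OF f]
      by (intro T.push_eqI) (simp_all add: Katetov_maps_def)
  qed
qed

section \<open>The isomorphism of the automorphism groups\<close>

lemma AutIso_Katetov_monoid:
  assumes "complete_metric_invariant_group X d"
  shows "AutIso (Katetov_monoid X d) (sup_dist (carrier X)) \<cong> AutIso X d"
proof -
  interpret X: complete_metric_invariant_group X d by fact
  let ?K = "Katetov_maps (carrier X) d"
  let ?A = "AutIso X d" and ?B = "AutIso (Katetov_monoid X d) (sup_dist (carrier X))"
  \<comment> \<open>The restriction to \<open>?K\<close> is needed because elements of
    \<open>Bij\<close> are extensional.\<close>
  define F where "F T = (\<lambda>f\<in>?K. compose (carrier X) f (inv_into (carrier X) T))" for T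
  have loc: "metric_invariant_group_iso X d X d T" if "T \<in> carrier ?A" for T
    using that metric_invariant_group_isoI[OF assms assms] by (simp add: AutIso_def)
  have F_carrier: "F T \<in> carrier ?B" if "T \<in> carrier ?A" for T
  proof -
    interpret T: metric_invariant_group_iso X d X d T
      using that by (rule loc)
    have "isometric_iso (Katetov_monoid X d) (sup_dist (carrier X))
        (Katetov_monoid X d) (sup_dist (carrier X)) (F T)"
      by (rule T.isometric_iso_push) (simp add: F_def)
    then show ?thesis
      by (auto simp: AutIso_def Bij_def isometric_iso_def iso_def F_def Katetov_monoid_def)
  qed
  have F_mult: "F (S \<otimes>\<^bsub>?A\<^esub> T) = F S \<otimes>\<^bsub>?B\<^esub> F T"
    if S: "S \<in> carrier ?A" and T: "T \<in> carrier ?A" for S T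
  proof -
    interpret S: metric_invariant_group_iso X d X d S using S by (rule loc)
    interpret T: metric_invariant_group_iso X d X d T using T by (rule loc)
    have ST: "(S \<otimes>\<^bsub>?A\<^esub> T) x = S (T x)" if "x \<in> carrier X" for x
      using S T that by (simp add: AutIso_def BijGroup_def compose_eq)
    have "S \<otimes>\<^bsub>?A\<^esub> T \<in> carrier ?A"
      using X.group_AutIso S T by (simp add: group.is_monoid monoid.m_closed)
    then interpret ST: metric_invariant_group_iso X d X d "S \<otimes>\<^bsub>?A\<^esub> T" by (rule loc)
    \<comment> \<open>Both sides take the value \<open>f x\<close> at \<open>S (T x)\<close>.
      Composing with inverses keeps the order of the factors, so \<open>F\<close> is a homomorphism
      and not an antihomomorphism.\<close>
    have "S.push (T.push f) = ST.push f" for f :: "_ \<Rightarrow> real"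
      by (rule ST.push_eqI)
        (simp_all add: ST T.T_closed S.push_apply T.push_apply)
    then have "F (S \<otimes>\<^bsub>?A\<^esub> T) = compose ?K (F S) (F T)"
      by (intro extensionalityI[of _ ?K]) (simp_all add: F_def compose_eq[of _ ?K] T.push_Katetov)
    also have "\<dots> = F S \<otimes>\<^bsub>?B\<^esub> F T"
      using F_carrier[OF S] F_carrier[OF T] by (simp add: AutIso_def BijGroup_def Katetov_monoid_def)
    finally show ?thesis .
  qed
  have "inj_on F (carrier ?A)"
  proof (rule inj_onI)
    fix S T assume S: "S \<in> carrier ?A" and T: "T \<in> carrier ?A" and eq: "F S = F T"
    interpret S: metric_invariant_group_iso X d X d S using S by (rule loc)
    interpret T: metric_invariant_group_iso X d X d T using T by (rule loc)
    show "S = T"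
    proof (rule extensionalityI)
      show "S \<in> extensional (carrier X)" "T \<in> extensional (carrier X)"
        using S T by (simp_all add: AutIso_def Bij_def)
      fix x assume x: "x \<in> carrier X"
      \<comment> \<open>Applying \<open>F S = F T\<close> to the point map of \<open>x\<close>
        compares the images of \<open>x\<close> itself.\<close>
      have "X.point_map (S x) = X.point_map (T x)"
        using fun_cong[OF eq, of "X.point_map x"] x
        by (simp add: F_def X.point_map_Katetov S.push_point_map T.push_point_map)
      then show "S x = T x"
        using X.inj_on_point_map x S.T_closed T.T_closed by (auto dest: inj_onD)
    qed
  qed
  moreover have "carrier ?B \<subseteq> F ` carrier ?A"
  proof
    fix \<Phi> assume \<Phi>: "\<Phi> \<in> carrier ?B"
    then have iso\<Phi>: "isometric_iso (Katetov_monoid X d) (sup_dist (carrier X))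
        (Katetov_monoid X d) (sup_dist (carrier X)) \<Phi>" and ext: "\<Phi> \<in> extensional ?K"
      by (auto simp: AutIso_def Bij_def Katetov_monoid_def)
    obtain T where T: "isometric_iso X d X d T"
      and \<Phi>T: "\<And>f. f \<in> ?K \<Longrightarrow> \<Phi> f = compose (carrier X) f (inv_into (carrier X) T)"
      using Katetov_iso_is_push[OF assms assms iso\<Phi>] by blast
    interpret T: metric_invariant_group_iso X d X d T
      using metric_invariant_group_isoI[OF assms assms T] .
    \<comment> \<open>The map \<open>T\<close> obtained may take any values off the carrier; its
      restriction is extensional, hence lies in \<open>Bij\<close>, and has the same push.\<close>
    let ?T = "restrict T (carrier X)"
    have T': "isometric_iso X d X d ?T"
      using T T.bij by (auto simp: isometric_iso_def iso_def hom_def)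
    interpret T': metric_invariant_group_iso X d X d ?T
      using metric_invariant_group_isoI[OF assms assms T'] .
    have "T.push f = T'.push f" for f :: "_ \<Rightarrow> real"
      by (rule T'.push_eqI) (auto simp: T.push_apply)
    then have "\<Phi> = F ?T"
      using ext \<Phi>T by (intro extensionalityI[of _ ?K]) (auto simp: F_def)
    moreover have "?T \<in> carrier ?A"
      using T' T'.bij by (simp add: AutIso_def Bij_def)
    ultimately show "\<Phi> \<in> F ` carrier ?A"
      by blast
  qed
  ultimately have "F \<in> iso ?A ?B"
    using F_carrier F_mult by (auto simp: iso_def hom_def bij_betw_def)
  then show ?thesis
    using group.iso_sym[OF X.group_AutIso] by (auto simp: is_iso_def)
qed

theorem theorem3:
  fixes X :: "('a, 'm) monoid_scheme" and d :: "'a \<Rightarrow> 'a \<Rightarrow> real"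
    and Y :: "('b, 'n) monoid_scheme" and d' :: "'b \<Rightarrow> 'b \<Rightarrow> real"
  assumes "complete_metric_invariant_group X d"
    and "complete_metric_invariant_group Y d'"
  shows "(\<forall>\<Phi> \<in> Katetov_maps (carrier X) d \<rightarrow> Katetov_maps (carrier Y) d'.
            isometric_iso (Katetov_monoid X d) (sup_dist (carrier X))
              (Katetov_monoid Y d') (sup_dist (carrier Y)) \<Phi> \<longleftrightarrow>
            (\<exists>T. isometric_iso X d Y d' T \<and>
              (\<forall>f \<in> Katetov_maps (carrier X) d.
                \<Phi> f = compose (carrier Y) f (inv_into (carrier X) T))))
       \<and> AutIso (Katetov_monoid X d) (sup_dist (carrier X)) \<cong> AutIso X d"
proof (intro conjI ballI iffI)
  fix \<Phi> assume "isometric_iso (Katetov_monoid X d) (sup_dist (carrier X))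
      (Katetov_monoid Y d') (sup_dist (carrier Y)) \<Phi>"
  then obtain T where "isometric_iso X d Y d' T"
    "\<And>f. f \<in> Katetov_maps (carrier X) d \<Longrightarrow>
      \<Phi> f = compose (carrier Y) f (inv_into (carrier X) T)"
    using Katetov_iso_is_push[OF assms] by blast
  then show "\<exists>T. isometric_iso X d Y d' T \<and> (\<forall>f \<in> Katetov_maps (carrier X) d.
      \<Phi> f = compose (carrier Y) f (inv_into (carrier X) T))"
    by blast
next
  fix \<Phi> assume "\<exists>T. isometric_iso X d Y d' T \<and> (\<forall>f \<in> Katetov_maps (carrier X) d.
      \<Phi> f = compose (carrier Y) f (inv_into (carrier X) T))"
  then show "isometric_iso (Katetov_monoid X d) (sup_dist (carrier X))
      (Katetov_monoid Y d') (sup_dist (carrier Y)) \<Phi>"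
    using metric_invariant_group_iso.isometric_iso_push[OF metric_invariant_group_isoI[OF assms]]
    by blast
next
  show "AutIso (Katetov_monoid X d) (sup_dist (carrier X)) \<cong> AutIso X d"
    using assms(1) by (rule AutIso_Katetov_monoid)
qed

end
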